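(* For every prenet $S$, the connected component $\mathcal W(S)$ of the category of weak equivalences contains a unique minimal prenet $m(S)$. Moreover, there exists a (not necessarily unique) weak equivalence $S\to m(S)$.
   Context: **2-prenets.** For a totally ordered finite set $S$, an interval is a subset $J\subset S$ such that $x<y<z$ with $x,z\in J$ implies $y\in J$; $\mathrm{Int}(S)$ is the set of nonempty intervals. For subsets, $U<V$ means $u<v$ for all $u\in U,v\in V$. A 2-prenet consists of totally ordered finite sets $S_0,S_1,S_2$ and parent maps $p_i:S_i\to\mathrm{Int}(S_{i-1})$, $i=1,2$ (written $p$ or $p_S$). Put $p^{-1}(t)=\{x: t\in p(x)\}$ (children of $t$), and let $<^\circ$ be the partial order on $S_i$ ($i\ge1$) generated by the relations $x<^\circ y$ for $x<y$ having a common parent. It is required that whenever $x<y$ in $S_i$ are incomparable for $<^\circ$, then $p(x)<p(y)$. For $U\subset S_i$, $p(U)=\bigcup_{x\in U}p(x)$. It is connected if $|S_0|=1$, and pruned if $p^{-1}(t)\neq\emptyset$ for all $t\in S_i$, $i<2$. A 2-prenet with tassels has in addition a subset $t(S)\subset S_2$ (tassels); $c(S_2)=S_2\setminus t(S)$ is the set of core vertices. **Maps.** For $U\subset S_i$, $A(U)$ (resp. $B(U)$) is the set of minimal (resp. maximal) elements of the sets $p^{-1}(z)\cap U$, $z\in p(U)$. A subset $V\subset S_i$ is a disjoint cover of $W\subset S_{i-1}$ if the sets $p(x)$, $x\in V$, are pairwise disjoint with union $W$. A map $f:S\to T$ is a collection $f_i:S_i\to T_i$ such that (a) $x<^\circ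 y$ implies $f(x)<^\circ f(y)$ or $f(x)=f(y)$; (b) $f^{-1}(p_T(x))=p_S(f^{-1}(x))$ for all $x\in T_i$, $i\ge1$; (c) $A(f^{-1}(x))$ and $B(f^{-1}(x))$ are disjoint covers of this set; (d) $f(c(S_2))\subset c(T_2)$. $2\mathrm{PreNet}$ is the category of connected pruned 2-prenets with tassels; "prenet" means an object of it, and isomorphic prenets are identified (so uniqueness is up to isomorphism). **Weak equivalences.** A map $f:S\to T$ in $2\mathrm{PreNet}$ is a weak equivalence if $f_2$ restricts to a bijection $c(S_2)\to c(T_2)$ and $p_S(x)=f^{-1}p_Tf(x)$ for all $x\in S_2$. They form a subcategory $\mathcal W$; $\mathcal W(S)$ is the connected component of $\mathcal W$ containing $S$. A prenet $S$ is minimal if every weak equivalence $S\to T$ is an isomorphism. *)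

theory Defs
  imports Main "HOL-Library.Disjoint_Sets"
begin

text \<open>
  The three totally ordered sets of a 2-prenet are finite sets of elements of a linearly ordered
  type, with the induced order.  Every finite totally ordered set is isomorphic to such a set in
  any infinite type (e.g. \<^typ>\<open>nat\<close>), and prenets are only considered up to isomorphism.
  Only the levels \<open>0, 1, 2\<close> of \<open>verts\<close>, and the values of \<open>parents S i\<close> on \<open>verts S i\<close> for
  \<open>i = 1, 2\<close>, carry meaning.
\<close>

record 'a prenet =
  verts :: "nat \<Rightarrow> 'a set"
  parents :: "nat \<Rightarrow> 'a \<Rightarrow> 'a set"
  tassels :: "'a set"

definition set_less :: "'a::linorder set \<Rightarrow> 'a set \<Rightarrow> bool" where
  "set_less U V \<longleftrightarrow> (\<forall>u\<in>U. \<forall>v\<in>V. u < v)"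

definition intervals :: "'a::linorder set \<Rightarrow> 'a set set" where
  "intervals S = {J. J \<subseteq> S \<and> J \<noteq> {} \<and>
     (\<forall>x\<in>J. \<forall>z\<in>J. \<forall>y\<in>S. x < y \<and> y < z \<longrightarrow> y \<in> J)}"

text \<open>\<open>children S i t\<close> is the set \<open>p\<^sup>-\<^sup>1(t)\<close> in level \<open>i\<close>, for \<open>t\<close> in level \<open>i - 1\<close>.\<close>

definition children :: "'a prenet \<Rightarrow> nat \<Rightarrow> 'a \<Rightarrow> 'a set" where
  "children S i t = {x \<in> verts S i. t \<in> parents S i x}"

definition parents_of :: "'a prenet \<Rightarrow> nat \<Rightarrow> 'a set \<Rightarrow> 'a set" where
  "parents_of S i U = (\<Union>x\<in>U. parents S i x)"

definition core :: "'a prenet \<Rightarrow> 'a set" where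
  "core S = verts S 2 - tassels S"

text \<open>The strict partial order \<open><\<^sup>\<circ>\<close> on level \<open>i\<close>.\<close>

definition circ_less :: "'a::linorder prenet \<Rightarrow> nat \<Rightarrow> 'a \<Rightarrow> 'a \<Rightarrow> bool" where
  "circ_less S i =
     (\<lambda>x y. x \<in> verts S i \<and> y \<in> verts S i \<and> x < y \<and> parents S i x \<inter> parents S i y \<noteq> {})\<^sup>+\<^sup>+"

definition two_prenet :: "'a::linorder prenet \<Rightarrow> bool" where
  "two_prenet S \<longleftrightarrow>
     (\<forall>i\<in>{0,1,2}. finite (verts S i)) \<and>
     (\<forall>i\<in>{1,2}. \<forall>x\<in>verts S i. parents S i x \<in> intervals (verts S (i - 1))) \<and>
     (\<forall>i\<in>{1,2}. \<forall>x\<in>verts S i. \<forall>y\<in>verts S i.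
        x < y \<and> \<not> circ_less S i x y \<and> \<not> circ_less S i y x \<longrightarrow>
        set_less (parents S i x) (parents S i y)) \<and>
     tassels S \<subseteq> verts S 2"

definition connected_prenet :: "'a prenet \<Rightarrow> bool" where
  "connected_prenet S \<longleftrightarrow> card (verts S 0) = 1"

definition pruned :: "'a prenet \<Rightarrow> bool" where
  "pruned S \<longleftrightarrow> (\<forall>i<2. \<forall>t\<in>verts S i. children S (Suc i) t \<noteq> {})"

text \<open>The objects of the category \<open>2PreNet\<close>.\<close>

definition is_prenet :: "'a::linorder prenet \<Rightarrow> bool" where
  "is_prenet S \<longleftrightarrow> two_prenet S \<and> connected_prenet S \<and> pruned S"

text \<open>
  On a set \<open>p\<^sup>-\<^sup>1(z)\<close> the orders \<open><\<close> and \<open><\<^sup>\<circ>\<close> agree and are total, so its finite nonempty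
  subsets have exactly one minimal and one maximal element.
\<close>

definition min_children :: "'a::linorder prenet \<Rightarrow> nat \<Rightarrow> 'a set \<Rightarrow> 'a set" where
  "min_children S i U = (\<lambda>z. Min (children S i z \<inter> U)) ` parents_of S i U"

definition max_children :: "'a::linorder prenet \<Rightarrow> nat \<Rightarrow> 'a set \<Rightarrow> 'a set" where
  "max_children S i U = (\<lambda>z. Max (children S i z \<inter> U)) ` parents_of S i U"

definition disjoint_cover :: "'a prenet \<Rightarrow> nat \<Rightarrow> 'a set \<Rightarrow> 'a set \<Rightarrow> bool" where
  "disjoint_cover S i V W \<longleftrightarrow> disjoint_family_on (parents S i) V \<and> (\<Union>x\<in>V. parents S i x) = W"

text \<open>The preimage of \<open>X\<close> under the level-\<open>i\<close> component of a map \<open>f\<close> with domain \<open>S\<close>.\<close>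

definition preim :: "'a prenet \<Rightarrow> (nat \<Rightarrow> 'a \<Rightarrow> 'b) \<Rightarrow> nat \<Rightarrow> 'b set \<Rightarrow> 'a set" where
  "preim S f i X = {y \<in> verts S i. f i y \<in> X}"

text \<open>
  A map is given by total functions of which only the restrictions to the vertex sets matter.
\<close>

definition prenet_map ::
  "'a::linorder prenet \<Rightarrow> 'b::linorder prenet \<Rightarrow> (nat \<Rightarrow> 'a \<Rightarrow> 'b) \<Rightarrow> bool" where
  "prenet_map S T f \<longleftrightarrow>
     (\<forall>i\<in>{0,1,2}. f i ` verts S i \<subseteq> verts T i) \<and>
     (\<forall>i\<in>{1,2}. \<forall>x\<in>verts S i. \<forall>y\<in>verts S i.
        circ_less S i x y \<longrightarrow> circ_less T i (f i x) (f i y) \<or> f i x = f i y) \<and>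
     (\<forall>i\<in>{1,2}. \<forall>x\<in>verts T i.
        preim S f (i - 1) (parents T i x) = parents_of S i (preim S f i {x})) \<and>
     (\<forall>i\<in>{1,2}. \<forall>x\<in>verts T i.
        disjoint_cover S i (min_children S i (preim S f i {x})) (preim S f (i - 1) (parents T i x)) \<and>
        disjoint_cover S i (max_children S i (preim S f i {x})) (preim S f (i - 1) (parents T i x))) \<and>
     f 2 ` core S \<subseteq> core T"

definition prenet_iso ::
  "'a::linorder prenet \<Rightarrow> 'b::linorder prenet \<Rightarrow> (nat \<Rightarrow> 'a \<Rightarrow> 'b) \<Rightarrow> bool" where
  "prenet_iso S T f \<longleftrightarrow> prenet_map S T f \<and>
     (\<exists>g. prenet_map T S g \<and>
        (\<forall>i\<in>{0,1,2}. (\<forall>x\<in>verts S i. g i (f i x) = x) \<and> (\<forall>y\<in>verts T i. f i (g i y) = y)))"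

definition isomorphic_prenets :: "'a::linorder prenet \<Rightarrow> 'b::linorder prenet \<Rightarrow> bool" where
  "isomorphic_prenets S T \<longleftrightarrow> (\<exists>f. prenet_iso S T f)"

definition weak_equivalence ::
  "'a::linorder prenet \<Rightarrow> 'b::linorder prenet \<Rightarrow> (nat \<Rightarrow> 'a \<Rightarrow> 'b) \<Rightarrow> bool" where
  "weak_equivalence S T f \<longleftrightarrow> is_prenet S \<and> is_prenet T \<and> prenet_map S T f \<and>
     bij_betw (f 2) (core S) (core T) \<and>
     (\<forall>x\<in>verts S 2. parents S 2 x = preim S f 1 (parents T 2 (f 2 x)))"

text \<open>
  The objects of the connected component \<open>\<W>(S)\<close>: the prenets joined to \<open>S\<close> by a finite zigzag of
  weak equivalences.
\<close>

definition weq_component :: "'a::linorder prenet \<Rightarrow> 'a prenet set" where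
  "weq_component S = {T. is_prenet T \<and> equivclp (\<lambda>U V. \<exists>f. weak_equivalence U V f) S T}"

definition minimal_prenet :: "'a::linorder prenet \<Rightarrow> bool" where
  "minimal_prenet S \<longleftrightarrow> is_prenet S \<and>
     (\<forall>(T :: 'a prenet) f. weak_equivalence S T f \<longrightarrow> prenet_iso S T f)"

end

theory Submission
  imports Defs
begin

text \<open>
  A weak equivalence is the same thing as a levelwise monotone surjection whose fibres consist of
  vertices with equal parents, which saturates all parent sets, and which is bijective on core
  vertices. Hence weak equivalences compose, an injective one is an isomorphism, and any other one
  decreases the number of vertices; so every prenet maps to a minimal one. Minimality is tested on
  the elementary quotients that merge a vertex with a neighbour: in a minimal prenet, adjacent
  vertices of level 1 have different children, and adjacent vertices of level 2 with equal parents
  are both core. Given two weak equivalences \<open>f : U \<rightarrow> M\<close> and \<open>f' : U \<rightarrow> M'\<close> with minimal targets, a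
  section \<open>s\<close> of \<open>f\<close> that lifts core vertices to core vertices therefore yields an isomorphism
  \<open>f' \<circ> s : M \<rightarrow> M'\<close>, so the minimal target is constant along a zigzag.
\<close>

section \<open>Order and parents in prenets\<close>

lemma mono_onD':
  fixes f :: "'a::linorder \<Rightarrow> 'b::linorder"
  assumes "mono_on A f" "x \<in> A" "y \<in> A" "f x < f y"
  shows "x < y"
  using assms by (meson leD mono_onD not_le_imp_less)

lemma circ_less_verts: "circ_less S i x y \<Longrightarrow> x \<in> verts S i \<and> y \<in> verts S i \<and> x < y"
  unfolding circ_less_def by (induction rule: tranclp_induct) auto

lemma circ_less_base:
  assumes "x \<in> verts S i" "y \<in> verts S i" "x < y" "t \<in> parents S i x" "t \<in> parents S i y"
  shows "circ_less S i x y"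
  unfolding circ_less_def using assms by (intro tranclp.r_into_trancl) blast

lemma circ_less_trans: "circ_less S i x y \<Longrightarrow> circ_less S i y z \<Longrightarrow> circ_less S i x z"
  unfolding circ_less_def by (rule tranclp_trans)

text \<open>A common parent \<open>t\<close> of two vertices yields the common parent
  \<open>g t\<close> of their images, so every generating relation is carried over. Chains follow by
  transitivity, with steps of equal image dropping out.\<close>

lemma circ_less_map:
  assumes maps: "f i ` verts S i \<subseteq> verts T i" and mono: "mono_on (verts S i) (f i)"
    and par: "\<And>x t. x \<in> verts S i \<Longrightarrow> t \<in> parents S i x \<Longrightarrow> g t \<in> parents T i (f i x)"
    and "circ_less S i x y"
  shows "circ_less T i (f i x) (f i y) \<or> f i x = f i y"
proof -
  have edge: "circ_less T i (f i x) (f i y) \<or> f i x = f i y"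
    if xy: "x \<in> verts S i" "y \<in> verts S i" "x < y" "parents S i x \<inter> parents S i y \<noteq> {}" for x y
  proof -
    obtain t where "t \<in> parents S i x" "t \<in> parents S i y" using xy by blast
    then have "g t \<in> parents T i (f i x)" "g t \<in> parents T i (f i y)" using par xy by auto
    moreover have "f i x \<le> f i y" using mono xy by (simp add: mono_onD)
    moreover have "f i x \<in> verts T i" "f i y \<in> verts T i" using maps xy by auto
    ultimately show ?thesis using circ_less_base by (metis order_le_less)
  qed
  show ?thesis using assms(4) unfolding circ_less_def[of S]
  proof (induction rule: tranclp_induct)
    case (base y)
    then show ?case using edge by blast
  next
    case (step y z)
    then show ?case using edge[of y z] circ_less_trans by metis
  qed
qed

lemma is_prenetD:
  assumes "is_prenet S"
  shows "i \<in> {0,1,2} \<Longrightarrow> finite (verts S i)"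
    and "i \<in> {1,2} \<Longrightarrow> x \<in> verts S i \<Longrightarrow> parents S i x \<subseteq> verts S (i - 1)"
    and "i \<in> {1,2} \<Longrightarrow> x \<in> verts S i \<Longrightarrow> parents S i x \<noteq> {}"
    and "\<lbrakk>i \<in> {1,2}; x \<in> verts S i; y \<in> verts S i; x < y; \<not> circ_less S i x y\<rbrakk> \<Longrightarrow>
           set_less (parents S i x) (parents S i y)"
proof -
  have S: "two_prenet S" using assms by (simp add: is_prenet_def)
  show "i \<in> {0,1,2} \<Longrightarrow> finite (verts S i)"
    using S unfolding two_prenet_def by blast
  have int: "i \<in> {1,2} \<Longrightarrow> x \<in> verts S i \<Longrightarrow> parents S i x \<in> intervals (verts S (i - 1))"
    using S unfolding two_prenet_def by blast
  then show "i \<in> {1,2} \<Longrightarrow> x \<in> verts S i \<Longrightarrow> parents S i x \<subseteq> verts S (i - 1)"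
    and "i \<in> {1,2} \<Longrightarrow> x \<in> verts S i \<Longrightarrow> parents S i x \<noteq> {}"
    unfolding intervals_def by blast+
  assume "i \<in> {1,2}" "x \<in> verts S i" "y \<in> verts S i" "x < y" "\<not> circ_less S i x y"
  \<comment> \<open>\<open>circ_less\<close> refines \<open><\<close>, so it cannot point from the
    larger vertex \<open>y\<close> to the smaller \<open>x\<close>.\<close>
  moreover have "\<not> circ_less S i y x" using circ_less_verts \<open>x < y\<close> by fastforce
  ultimately show "set_less (parents S i x) (parents S i y)"
    using S unfolding two_prenet_def by blast
qed

lemma is_prenet_verts_0: "is_prenet S \<Longrightarrow> \<exists>a. verts S 0 = {a}"
  by (simp add: is_prenet_def connected_prenet_def card_1_singleton_iff)

text \<open>Level 0 is a singleton and parent sets are nonempty, so only one value is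
  possible.\<close>

lemma is_prenet_parents_1: "is_prenet S \<Longrightarrow> x \<in> verts S 1 \<Longrightarrow> parents S 1 x = verts S 0"
  using is_prenetD(2,3)[of S 1 x] is_prenet_verts_0[of S] by auto

section \<open>Weak equivalences as saturated monotone surjections\<close>

definition saturated_epi ::
  "'a::linorder prenet \<Rightarrow> 'b::linorder prenet \<Rightarrow> (nat \<Rightarrow> 'a \<Rightarrow> 'b) \<Rightarrow> bool" where
  "saturated_epi S T f \<longleftrightarrow>
     (\<forall>i\<in>{0,1,2}. f i ` verts S i = verts T i \<and> mono_on (verts S i) (f i)) \<and>
     (\<forall>i\<in>{1,2}. \<forall>x\<in>verts S i. parents S i x = preim S f (i - 1) (parents T i (f i x))) \<and>
     bij_betw (f 2) (core S) (core T)"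

text \<open>By saturation all vertices of a fibre \<open>F\<close> have the same parent set
  \<open>P\<close>. Hence every element of \<open>P\<close> has the whole of \<open>F\<close> among
  its children, the minimal and maximal children reduce to \<open>{Min F}\<close> and
  \<open>{Max F}\<close>, and each of these single vertices covers \<open>P\<close>.\<close>

lemma saturated_epi_imp_map:
  assumes S: "is_prenet S" and T: "is_prenet T" and f: "saturated_epi S T f"
  shows "prenet_map S T f"
proof -
  have surj: "f i ` verts S i = verts T i" and mono: "mono_on (verts S i) (f i)"
    if "i \<in> {0,1,2}" for i
    using f that unfolding saturated_epi_def by blast+
  have sat: "parents S i x = preim S f (i - 1) (parents T i (f i x))"
    if "i \<in> {1,2}" "x \<in> verts S i" for i x
    using f that unfolding saturated_epi_def by blast
  have circ: "circ_less T i (f i x) (f i y) \<or> f i x = f i y"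
    if "i \<in> {1,2}" "circ_less S i x y" for i x y
  proof (rule circ_less_map[OF _ _ _ that(2)])
    show "f i ` verts S i \<subseteq> verts T i" "mono_on (verts S i) (f i)" using surj mono that by blast+
    show "f (i - 1) t \<in> parents T i (f i x)" if "x \<in> verts S i" "t \<in> parents S i x" for x t
      using sat[OF \<open>i \<in> {1,2}\<close> that(1)] that(2) by (auto simp: preim_def)
  qed
  have fib: "preim S f (i - 1) (parents T i x) = parents_of S i (preim S f i {x}) \<and>
     disjoint_cover S i (min_children S i (preim S f i {x})) (preim S f (i - 1) (parents T i x)) \<and>
     disjoint_cover S i (max_children S i (preim S f i {x})) (preim S f (i - 1) (parents T i x))"
    if i: "i \<in> {1,2}" and x: "x \<in> verts T i" for i x
  proof -
    define F where "F = preim S f i {x}"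
    define P where "P = preim S f (i - 1) (parents T i x)"
    have PF: "parents S i y = P" if "y \<in> F" for y
      using sat[OF i, of y] that by (auto simp: F_def P_def preim_def)
    have "x \<in> f i ` verts S i" using surj[of i] i x by blast
    then have F: "F \<noteq> {}" "F \<subseteq> verts S i" by (auto simp: F_def preim_def)
    have fin: "finite F" using F(2) is_prenetD(1)[OF S, of i] i finite_subset by blast
    have P: "P \<noteq> {}" using F PF is_prenetD(3)[OF S i] by blast
    have po: "parents_of S i F = P" using F(1) PF by (auto simp: parents_of_def)
    have ch: "children S i z \<inter> F = F" if "z \<in> P" for z
      using that F PF by (auto simp: children_def)
    have mn: "min_children S i F = {Min F}" and mx: "max_children S i F = {Max F}"
      unfolding min_children_def max_children_def po using P ch by auto
    have "disjoint_cover S i {y} P" if "y \<in> F" for y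
      using PF[OF that] by (simp add: disjoint_cover_def disjoint_family_on_def)
    then show ?thesis
      unfolding F_def[symmetric] P_def[symmetric] po mn mx using F(1) fin by simp
  qed
  have core: "f 2 ` core S \<subseteq> core T" using f by (auto simp: saturated_epi_def bij_betw_def)
  show ?thesis unfolding prenet_map_def
    by (intro conjI ballI impI)
      (assumption | rule core equalityD1[OF surj] circ fib[THEN conjunct1]
        fib[THEN conjunct2, THEN conjunct1] fib[THEN conjunct2, THEN conjunct2])+
qed

lemma prenet_mapD:
  assumes "prenet_map S T f"
  shows "i \<in> {0,1,2} \<Longrightarrow> f i ` verts S i \<subseteq> verts T i"
    and "\<lbrakk>i \<in> {1,2}; circ_less S i x y\<rbrakk> \<Longrightarrow> circ_less T i (f i x) (f i y) \<or> f i x = f i y"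
    and "\<lbrakk>i \<in> {1,2}; z \<in> verts T i\<rbrakk> \<Longrightarrow>
           preim S f (i - 1) (parents T i z) = parents_of S i (preim S f i {z})"
proof -
  note m = assms[unfolded prenet_map_def]
  show "i \<in> {0,1,2} \<Longrightarrow> f i ` verts S i \<subseteq> verts T i"
    by (rule m[THEN conjunct1, rule_format])
  show "\<lbrakk>i \<in> {1,2}; circ_less S i x y\<rbrakk> \<Longrightarrow> circ_less T i (f i x) (f i y) \<or> f i x = f i y"
    using m[THEN conjunct2, THEN conjunct1, rule_format, of i x y] circ_less_verts by metis
  show "\<lbrakk>i \<in> {1,2}; z \<in> verts T i\<rbrakk> \<Longrightarrow>
           preim S f (i - 1) (parents T i z) = parents_of S i (preim S f i {z})"
    by (rule m[THEN conjunct2, THEN conjunct2, THEN conjunct1, rule_format])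
qed

text \<open>A common parent of two images lifts to level 1 of \<open>S\<close>, and saturation makes
  the lift a common parent of the given vertices; if these stood in the wrong order, their images
  would too. Intermediate vertices of a chain lift by surjectivity on level 2. This prepares
  monotonicity on level 2.\<close>

lemma weak_equivalence_reflects_circ_less:
  assumes w: "weak_equivalence S T f" and surj: "\<And>i. i \<in> {1,2} \<Longrightarrow> f i ` verts S i = verts T i"
    and "circ_less T 2 a b"
  shows "\<And>x y. \<lbrakk>x \<in> verts S 2; y \<in> verts S 2; f 2 x = a; f 2 y = b\<rbrakk> \<Longrightarrow> circ_less S 2 x y"
proof -
  have m: "prenet_map S T f" and T: "is_prenet T"
    and sat: "\<And>x. x \<in> verts S 2 \<Longrightarrow> parents S 2 x = preim S f 1 (parents T 2 (f 2 x))"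
    using w by (auto simp: weak_equivalence_def)
  have *: "circ_less S 2 x y"
    if xy: "x \<in> verts S 2" "y \<in> verts S 2"
      "f 2 x < f 2 y" "parents T 2 (f 2 x) \<inter> parents T 2 (f 2 y) \<noteq> {}" for x y
  proof -
    obtain t where t: "t \<in> parents T 2 (f 2 x)" "t \<in> parents T 2 (f 2 y)" using xy by blast
    have "f 2 x \<in> verts T 2" using surj[of 2] xy(1) by blast
    then have "t \<in> f 1 ` verts S 1"
      using t(1) is_prenetD(2)[OF T, of 2 "f 2 x"] surj[of 1] by auto
    then obtain s where "s \<in> verts S 1" "f 1 s = t" by blast
    then have s: "s \<in> parents S 2 x" "s \<in> parents S 2 y"
      using sat xy t by (auto simp: preim_def)
    have "\<not> y < x"
    proof
      assume "y < x"
      then have "circ_less S 2 y x" using circ_less_base xy s by metis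
      then have "circ_less T 2 (f 2 y) (f 2 x) \<or> f 2 y = f 2 x"
        using prenet_mapD(2)[OF m, of 2] by simp
      then show False using circ_less_verts xy(3) by fastforce
    qed
    moreover have "x \<noteq> y" using xy(3) by auto
    ultimately show ?thesis using circ_less_base xy s by (metis not_less_iff_gr_or_eq)
  qed
  show "circ_less S 2 x y" if "x \<in> verts S 2" "y \<in> verts S 2" "f 2 x = a" "f 2 y = b" for x y
    using assms(3) that unfolding circ_less_def[of T]
  proof (induction arbitrary: y rule: tranclp_induct)
    case (base b)
    then show ?case using * by blast
  next
    case (step b c)
    then have "b \<in> f 2 ` verts S 2" using surj[of 2] by blast
    then obtain z where z: "z \<in> verts S 2" "f 2 z = b" by blast
    then have "circ_less S 2 x z" using step by blast
    moreover have "circ_less S 2 z y" using * z step by blast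
    ultimately show ?case by (rule circ_less_trans)
  qed
qed

lemma weak_equivalence_iff:
  "weak_equivalence S T f \<longleftrightarrow> is_prenet S \<and> is_prenet T \<and> saturated_epi S T f"
proof
  assume "is_prenet S \<and> is_prenet T \<and> saturated_epi S T f"
  then show "weak_equivalence S T f"
    using saturated_epi_imp_map[of S T f] by (auto simp: weak_equivalence_def saturated_epi_def)
next
  assume w: "weak_equivalence S T f"
  then have S: "is_prenet S" and T: "is_prenet T" and m: "prenet_map S T f"
    and bij: "bij_betw (f 2) (core S) (core T)"
    and sat2: "\<And>x. x \<in> verts S 2 \<Longrightarrow> parents S 2 x = preim S f 1 (parents T 2 (f 2 x))"
    by (auto simp: weak_equivalence_def)
  have maps: "f i ` verts S i \<subseteq> verts T i" if "i \<in> {0,1,2}" for i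
    using prenet_mapD(1)[OF m that] .
  have circ: "f i x < f i y \<or> f i x = f i y" if "i \<in> {1,2}" "circ_less S i x y" for i x y
    using prenet_mapD(2)[OF m that] circ_less_verts by metis
  have pre: "preim S f (i - 1) (parents T i x) = parents_of S i (preim S f i {x})"
    if "i \<in> {1,2}" "x \<in> verts T i" for i x
    using prenet_mapD(3)[OF m that] .
  obtain a b where ab: "verts S 0 = {a}" "verts T 0 = {b}"
    using is_prenet_verts_0 S T by meson
  have f0: "f 0 a = b" using maps[of 0] ab by auto
  \<comment> \<open>Surjectivity climbs from one level to the next: a parent of \<open>x\<close> has
    a lift, so by \<open>pre\<close> the fibre over \<open>x\<close> cannot be empty.\<close>
  have surj: "f i ` verts S i = verts T i" if below: "f (i - 1) ` verts S (i - 1) = verts T (i - 1)"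
    and i: "i \<in> {1,2}" for i
  proof
    show "f i ` verts S i \<subseteq> verts T i" using maps i by blast
    show "verts T i \<subseteq> f i ` verts S i"
    proof
      fix x assume x: "x \<in> verts T i"
      obtain t where "t \<in> parents T i x" using is_prenetD(3)[OF T i x] by blast
      then have "t \<in> f (i - 1) ` verts S (i - 1)" using is_prenetD(2)[OF T i x] below by blast
      then have "preim S f (i - 1) (parents T i x) \<noteq> {}"
        using \<open>t \<in> parents T i x\<close> by (auto simp: preim_def)
      then have "preim S f i {x} \<noteq> {}" using pre[OF i x] by (auto simp: parents_of_def)
      then show "x \<in> f i ` verts S i" by (auto simp: preim_def)
    qed
  qed
  have s0: "f 0 ` verts S 0 = verts T 0" using ab f0 by simp
  have s1: "f 1 ` verts S 1 = verts T 1" using surj[of 1] s0 by simp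
  have s2: "f 2 ` verts S 2 = verts T 2" using surj[of 2] s1 by simp
  \<comment> \<open>All vertices of level 1 share the parent \<open>a\<close>, so there
    \<open>circ_less\<close> is the full order.\<close>
  have m1: "mono_on (verts S 1) (f 1)"
  proof (rule mono_onI)
    fix x y assume xy: "x \<in> verts S 1" "y \<in> verts S 1" "x \<le> y"
    show "f 1 x \<le> f 1 y"
    proof (cases "x = y")
      case False
      then have "circ_less S 1 x y"
        using xy is_prenet_parents_1[OF S] ab by (intro circ_less_base[of _ _ _ _ a]) auto
      then show ?thesis using circ[of 1 x y] by auto
    qed simp
  qed
  \<comment> \<open>An inverted pair is incomparable for \<open>circ_less\<close> in
    \<open>S\<close>, and by reflection its images are incomparable in \<open>T\<close>. The prenet
    axiom then orders the parent sets in opposite ways in \<open>S\<close> and in \<open>T\<close>,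
    which contradicts monotonicity of \<open>f 1\<close>.\<close>
  have m2: "mono_on (verts S 2) (f 2)"
  proof (rule mono_onI, rule ccontr)
    fix x y assume xy: "x \<in> verts S 2" "y \<in> verts S 2" "x \<le> y" and "\<not> f 2 x \<le> f 2 y"
    then have less: "f 2 y < f 2 x" "x < y" by (auto simp: order_le_less)
    have "\<not> circ_less S 2 x y" using circ[of 2 x y] less by force
    then have p: "set_less (parents S 2 x) (parents S 2 y)" using is_prenetD(4)[OF S] xy less by simp
    have "\<not> circ_less S 2 y x" using circ_less_verts less by fastforce
    moreover have "circ_less S 2 y x" if "circ_less T 2 (f 2 y) (f 2 x)"
      by (rule weak_equivalence_reflects_circ_less[OF w _ that]) (use s1 s2 xy in auto)
    moreover have "f 2 x \<in> verts T 2" "f 2 y \<in> verts T 2" using s2 xy by blast+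
    ultimately have q: "set_less (parents T 2 (f 2 y)) (parents T 2 (f 2 x))"
      using is_prenetD(4)[OF T, of 2] less by blast
    obtain s t where st: "s \<in> parents S 2 x" "t \<in> parents S 2 y"
      using is_prenetD(3)[OF S, of 2] xy by (meson ex_in_conv insertCI)
    then have "s < t" using p by (auto simp: set_less_def)
    moreover have "s \<in> verts S 1" "t \<in> verts S 1" "f 1 t < f 1 s"
      using st sat2[OF xy(1)] sat2[OF xy(2)] q by (auto simp: preim_def set_less_def)
    ultimately show False using mono_onD'[OF m1] by fastforce
  qed
  have sat1: "parents S 1 x = preim S f 0 (parents T 1 (f 1 x))" if "x \<in> verts S 1" for x
  proof -
    have "f 1 x \<in> verts T 1" using s1 that by blast
    then have "parents T 1 (f 1 x) = verts T 0" "parents S 1 x = verts S 0"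
      using is_prenet_parents_1 S T that by blast+
    then show ?thesis using ab f0 by (auto simp: preim_def)
  qed
  have "mono_on (verts S 0) (f 0)" using ab by (simp add: mono_on_def)
  then show "is_prenet S \<and> is_prenet T \<and> saturated_epi S T f"
    unfolding saturated_epi_def using S T s0 s1 s2 m1 m2 sat1 sat2 bij by simp
qed

text \<open>Saturation is put elementwise, as an equivalence of memberships, so that it passes
  easily along composites, inverses and sections.\<close>

lemma weak_equivalenceD:
  assumes "weak_equivalence S T f"
  shows "is_prenet S" "is_prenet T"
    and "i \<in> {0,1,2} \<Longrightarrow> f i ` verts S i = verts T i"
    and "i \<in> {0,1,2} \<Longrightarrow> mono_on (verts S i) (f i)"
    and "\<lbrakk>i \<in> {1,2}; x \<in> verts S i; t \<in> verts S (i - 1)\<rbrakk> \<Longrightarrow>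
           f (i - 1) t \<in> parents T i (f i x) \<longleftrightarrow> t \<in> parents S i x"
    and "bij_betw (f 2) (core S) (core T)"
proof -
  have *: "is_prenet S" "is_prenet T" "saturated_epi S T f"
    using assms by (auto simp: weak_equivalence_iff)
  then show "is_prenet S" "is_prenet T" "bij_betw (f 2) (core S) (core T)"
    and "i \<in> {0,1,2} \<Longrightarrow> f i ` verts S i = verts T i"
    and "i \<in> {0,1,2} \<Longrightarrow> mono_on (verts S i) (f i)"
    unfolding saturated_epi_def by blast+
  assume a: "i \<in> {1,2}" "x \<in> verts S i" "t \<in> verts S (i - 1)"
  then have "parents S i x = preim S f (i - 1) (parents T i (f i x))"
    using *(3) unfolding saturated_epi_def by blast
  then show "f (i - 1) t \<in> parents T i (f i x) \<longleftrightarrow> t \<in> parents S i x"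
    using a(3) by (simp add: preim_def)
qed

lemma weak_equivalenceI:
  assumes S: "is_prenet S" and "is_prenet T"
    and "\<And>i. i \<in> {0,1,2} \<Longrightarrow> f i ` verts S i = verts T i"
    and "\<And>i. i \<in> {0,1,2} \<Longrightarrow> mono_on (verts S i) (f i)"
    and par: "\<And>i x t. \<lbrakk>i \<in> {1,2}; x \<in> verts S i; t \<in> verts S (i - 1)\<rbrakk> \<Longrightarrow>
           f (i - 1) t \<in> parents T i (f i x) \<longleftrightarrow> t \<in> parents S i x"
    and "bij_betw (f 2) (core S) (core T)"
  shows "weak_equivalence S T f"
proof -
  have sat: "parents S i x = preim S f (i - 1) (parents T i (f i x))"
    if "i \<in> {1,2}" "x \<in> verts S i" for i x
    using is_prenetD(2)[OF S that] par[OF that] by (auto simp: preim_def)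
  show ?thesis unfolding weak_equivalence_iff saturated_epi_def
    by (intro conjI ballI) (assumption | rule assms sat)+
qed

section \<open>Identities, composites and isomorphisms\<close>

lemma weak_equivalence_id: "is_prenet S \<Longrightarrow> weak_equivalence S S (\<lambda>i x. x)"
  by (rule weak_equivalenceI) (auto simp: mono_on_def bij_betw_def)

lemma weak_equivalence_comp:
  assumes f: "weak_equivalence S T f" and g: "weak_equivalence T U g"
  shows "weak_equivalence S U (\<lambda>i. g i \<circ> f i)"
proof (rule weak_equivalenceI)
  note F = weak_equivalenceD[OF f] and G = weak_equivalenceD[OF g]
  show "is_prenet S" "is_prenet U" by (fact F G)+
  show "bij_betw (g 2 \<circ> f 2) (core S) (core U)" using F(6) G(6) by (rule bij_betw_trans)
  show "(g i \<circ> f i) ` verts S i = verts U i" if "i \<in> {0,1,2}" for i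
    using F(3)[OF that] G(3)[OF that] by (metis image_comp)
  show "mono_on (verts S i) (g i \<circ> f i)" if "i \<in> {0,1,2}" for i
    using F(3,4)[OF that] G(4)[OF that] by (metis monotone_on_o order_refl)
  show "(g (i - 1) \<circ> f (i - 1)) t \<in> parents U i ((g i \<circ> f i) x) \<longleftrightarrow> t \<in> parents S i x"
    if i: "i \<in> {1,2}" and x: "x \<in> verts S i" and t: "t \<in> verts S (i - 1)" for i x t
  proof -
    have "i \<in> {0,1,2}" "i - 1 \<in> {0,1,2}" using i by auto
    then have "f i x \<in> verts T i" "f (i - 1) t \<in> verts T (i - 1)"
      using F(3) x t by blast+
    then show ?thesis using F(5)[OF i x t] G(5)[OF i] by simp
  qed
qed

text \<open>Such a map is bijective on every level, and the inverse is again a weak equivalence: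
  monotone because the orders are total, saturated because saturation is an equivalence of
  memberships.\<close>

lemma weak_equivalence_inj_imp_iso:
  assumes f: "weak_equivalence S T f" and inj: "\<And>i. i \<in> {0,1,2} \<Longrightarrow> inj_on (f i) (verts S i)"
  shows "prenet_iso S T f"
proof -
  note F = weak_equivalenceD[OF f]
  define g where "g = (\<lambda>i. inv_into (verts S i) (f i))"
  have gf: "g i (f i x) = x" if "i \<in> {0,1,2}" "x \<in> verts S i" for i x
    using inj that by (simp add: g_def)
  have fg: "f i (g i y) = y" and gv: "g i y \<in> verts S i" if "i \<in> {0,1,2}" "y \<in> verts T i" for i y
    using F(3)[OF that(1)] that(2) by (auto simp: g_def f_inv_into_f inv_into_into)
  have "weak_equivalence T S g"
  proof (rule weak_equivalenceI)
    show "is_prenet S" "is_prenet T" by (fact F)+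
    show "g i ` verts T i = verts S i" if "i \<in> {0,1,2}" for i
      using gv[OF that] gf[OF that] F(3)[OF that] by force
    show "mono_on (verts T i) (g i)" if "i \<in> {0,1,2}" for i
    proof (rule mono_onI, rule ccontr)
      fix x y assume xy: "x \<in> verts T i" "y \<in> verts T i" "x \<le> y" "\<not> g i x \<le> g i y"
      then have "f i (g i y) \<le> f i (g i x)" using F(4)[OF that] gv that by (simp add: mono_onD)
      then show False using xy fg that by (metis order_antisym order_refl)
    qed
    show "g (i - 1) t \<in> parents S i (g i x) \<longleftrightarrow> t \<in> parents T i x"
      if i: "i \<in> {1,2}" and x: "x \<in> verts T i" and t: "t \<in> verts T (i - 1)" for i x t
    proof -
      have "i \<in> {0,1,2}" "i - 1 \<in> {0,1,2}" using i by auto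
      then show ?thesis using F(5)[OF i gv gv] fg x t by metis
    qed
    have cS: "core S \<subseteq> verts S 2" by (auto simp: core_def)
    show "bij_betw (g 2) (core T) (core S)"
    proof -
      have "bij_betw (inv_into (core S) (f 2)) (core T) (core S)"
        using F(6) by (rule bij_betw_inv_into)
      \<comment> \<open>\<open>g 2\<close> picks its preimage from all of level 2; by injectivity
        this is the core preimage.\<close>
      moreover have "inv_into (core S) (f 2) y = g 2 y" if "y \<in> core T" for y
      proof -
        have "y \<in> f 2 ` core S" using bij_betw_imp_surj_on[OF F(6)] that by simp
        then obtain x where x: "x \<in> core S" "y = f 2 x" by (rule imageE) simp
        then have "g 2 (f 2 x) = x" using gf[of 2 x] cS by blast
        then show ?thesis using x bij_betw_inv_into_left[OF F(6)] by simp
      qed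
      ultimately show ?thesis by (simp cong: bij_betw_cong)
    qed
  qed
  then show ?thesis
    using f gf fg unfolding prenet_iso_def weak_equivalence_def by blast
qed

lemma prenet_iso_inj: "prenet_iso S T f \<Longrightarrow> i \<in> {0,1,2} \<Longrightarrow> inj_on (f i) (verts S i)"
  unfolding prenet_iso_def by (metis inj_onI)

section \<open>Quotients by idempotents\<close>

definition retraction :: "'a::linorder prenet \<Rightarrow> (nat \<Rightarrow> 'a \<Rightarrow> 'a) \<Rightarrow> bool" where
  "retraction S r \<longleftrightarrow>
     (\<forall>i\<in>{0,1,2}. r i ` verts S i \<subseteq> verts S i \<and> mono_on (verts S i) (r i) \<and>
        (\<forall>x\<in>verts S i. r i (r i x) = r i x)) \<and>
     (\<forall>i\<in>{1,2}. \<forall>x\<in>verts S i. parents S i (r i x) = parents S i x \<and>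
        (\<forall>t\<in>verts S (i - 1). r (i - 1) t \<in> parents S i x \<longleftrightarrow> t \<in> parents S i x)) \<and>
     inj_on (r 2) (core S)"

text \<open>The quotient is realised as the image inside \<open>S\<close>, so it stays in the type
  over which minimality quantifies. An image vertex is a tassel exactly when no core vertex is sent
  to it.\<close>

definition retract :: "'a::linorder prenet \<Rightarrow> (nat \<Rightarrow> 'a \<Rightarrow> 'a) \<Rightarrow> 'a prenet" where
  "retract S r =
     \<lparr>verts = (\<lambda>i. r i ` verts S i),
      parents = (\<lambda>i x. parents S i x \<inter> r (i - 1) ` verts S (i - 1)),
      tassels = r 2 ` verts S 2 - r 2 ` core S\<rparr>"

text \<open>Restricting parent sets to the image loses no information, since \<open>r\<close> moves
  a vertex only to one that lies in the same parent sets and has the same parents; this is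
  \<open>mem\<close>. The prenet axioms then pass to the image, which \<open>r\<close> fixes
  pointwise.\<close>

lemma weak_equivalence_retract:
  assumes S: "is_prenet S" and r: "retraction S r"
  shows "weak_equivalence S (retract S r) r"
proof -
  let ?T = "retract S r"
  have maps: "r i ` verts S i \<subseteq> verts S i" and mono: "mono_on (verts S i) (r i)"
    and idem: "\<And>x. x \<in> verts S i \<Longrightarrow> r i (r i x) = r i x" if "i \<in> {0,1,2}" for i
    using r that unfolding retraction_def by blast+
  have par: "parents S i (r i x) = parents S i x" if "i \<in> {1,2}" "x \<in> verts S i" for i x
    using r that unfolding retraction_def by blast
  have sat: "r (i - 1) t \<in> parents S i x \<longleftrightarrow> t \<in> parents S i x"
    if "i \<in> {1,2}" "x \<in> verts S i" "t \<in> verts S (i - 1)" for i x t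
    using r that unfolding retraction_def by blast
  have inj: "inj_on (r 2) (core S)" using r by (simp add: retraction_def)
  have T: "verts ?T i = r i ` verts S i"
    "parents ?T i x = parents S i x \<inter> r (i - 1) ` verts S (i - 1)"
    "tassels ?T = r 2 ` verts S 2 - r 2 ` core S" for i x
    by (simp_all add: retract_def)
  have low: "i \<in> {0,1,2}" "i - 1 \<in> {0,1,2}" if "i \<in> {1,2}" for i :: nat using that by auto
  have sub: "verts ?T i \<subseteq> verts S i" if "i \<in> {0,1,2}" for i using maps[OF that] T by simp
  have fix_T: "r i x = x" if "i \<in> {0,1,2}" "x \<in> verts ?T i" for i x
    using idem[OF that(1)] that(2) by (auto simp: T(1))
  have mem: "r (i - 1) t \<in> parents ?T i (r i x) \<longleftrightarrow> t \<in> parents S i x"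
    if "i \<in> {1,2}" "x \<in> verts S i" "t \<in> verts S (i - 1)" for i x t
    using par[OF that(1,2)] sat[OF that] that(3) by (simp add: T)
  have int: "parents ?T i x \<in> intervals (verts ?T (i - 1))"
    if i: "i \<in> {1,2}" and x: "x \<in> verts ?T i" for i x
  proof -
    have x': "x \<in> verts S i" using sub low i x by blast
    have "parents S i x \<in> intervals (verts S (i - 1))"
      using S i x' unfolding is_prenet_def two_prenet_def by blast
    \<comment> \<open>The restricted interval stays nonempty because \<open>r\<close> moves a parent
      into the image without leaving the parent set.\<close>
    moreover obtain t where "t \<in> parents S i x" using is_prenetD(3)[OF S i x'] by blast
    then have "r (i - 1) t \<in> parents ?T i x"
      using mem[OF i x'] is_prenetD(2)[OF S i x'] fix_T[OF low(1)[OF i] x] by auto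
    ultimately show ?thesis
      using sub[OF low(2)[OF i]] unfolding intervals_def T by blast
  qed
  have ord: "set_less (parents ?T i x) (parents ?T i y)"
    if i: "i \<in> {1,2}" and xy: "x \<in> verts ?T i" "y \<in> verts ?T i" "x < y" "\<not> circ_less ?T i x y"
    for i x y
  proof -
    have xy': "x \<in> verts S i" "y \<in> verts S i" using sub low i xy by blast+
    \<comment> \<open>A chain in \<open>S\<close> from \<open>x\<close> to \<open>y\<close> may
      leave the image, but \<open>r\<close> pushes it back while fixing both ends.\<close>
    have "\<not> circ_less S i x y"
    proof
      assume *: "circ_less S i x y"
      have "circ_less ?T i (r i x) (r i y) \<or> r i x = r i y"
      proof (rule circ_less_map[OF _ _ _ *, where g = "r (i - 1)"])
        show "r i ` verts S i \<subseteq> verts ?T i" by (simp add: T)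
        show "mono_on (verts S i) (r i)" using mono low i by blast
        show "r (i - 1) t \<in> parents ?T i (r i x)" if "x \<in> verts S i" "t \<in> parents S i x" for x t
          using mem[OF i that(1)] is_prenetD(2)[OF S i that(1)] that(2) by blast
      qed
      then show False using fix_T[OF low(1)[OF i]] xy by auto
    qed
    then have "set_less (parents S i x) (parents S i y)"
      using is_prenetD(4)[OF S i] xy xy' by blast
    then show ?thesis by (simp add: set_less_def T)
  qed
  have "is_prenet ?T" unfolding is_prenet_def
  proof (intro conjI)
    have "finite (verts ?T i)" if "i \<in> {0,1,2}" for i
      using is_prenetD(1)[OF S that] by (simp add: T)
    moreover have "tassels ?T \<subseteq> verts ?T 2" by (auto simp: T)
    ultimately show "two_prenet ?T" unfolding two_prenet_def
      by (intro conjI ballI impI; (elim conjE)?) (assumption | rule int ord)+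
    show "connected_prenet ?T"
      using is_prenet_verts_0[OF S] by (auto simp: connected_prenet_def T)
    show "pruned ?T" unfolding pruned_def
    proof (intro allI impI ballI)
      fix i :: nat and t assume i: "i < 2" and t: "t \<in> verts ?T i"
      then have i': "i \<in> {0,1,2}" "Suc i \<in> {1,2}" by auto
      have tS: "t \<in> verts S i" using sub[OF i'(1)] t by blast
      then obtain x where x: "x \<in> verts S (Suc i)" "t \<in> parents S (Suc i) x"
        using S i unfolding is_prenet_def pruned_def children_def by blast
      \<comment> \<open>The child of \<open>t\<close> in the quotient is the image of a child of
        \<open>t\<close> in \<open>S\<close>.\<close>
      then have "r i t \<in> parents ?T (Suc i) (r (Suc i) x)" using mem[OF i'(2)] tS by simp
      then show "children ?T (Suc i) t \<noteq> {}"
        using fix_T[OF i'(1) t] x(1) by (auto simp: children_def T(1))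
    qed
  qed
  then show ?thesis
  proof (rule weak_equivalenceI[OF S])
    have "core ?T = r 2 ` core S" by (auto simp: core_def T)
    then show "bij_betw (r 2) (core S) (core ?T)" using inj by (simp add: bij_betw_def)
  qed (use mono mem T(1) in auto)
qed

section \<open>Local consequences of minimality\<close>

lemma minimal_retraction_inj:
  assumes "minimal_prenet M" "retraction M r" "i \<in> {0,1,2}"
  shows "inj_on (r i) (verts M i)"
  using assms weak_equivalence_retract prenet_iso_inj unfolding minimal_prenet_def by metis

definition merge :: "nat \<Rightarrow> 'a \<Rightarrow> 'a \<Rightarrow> nat \<Rightarrow> 'a \<Rightarrow> 'a" where
  "merge k x y i z = (if i = k \<and> z = x then y else z)"

text \<open>Moving \<open>x\<close> onto \<open>y\<close> jumps over no element of \<open>A\<close>,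
  whichever of the two is larger.\<close>

lemma mono_on_merge:
  fixes x y :: "'a::linorder"
  assumes "y \<in> A" "\<And>z. z \<in> A \<Longrightarrow> \<not> (x < z \<and> z < y) \<and> \<not> (y < z \<and> z < x)"
  shows "mono_on A (merge k x y i)"
  using assms by (force simp: mono_on_def merge_def)

text \<open>Merging \<open>x\<close> into \<open>y\<close> would be a retraction that is not
  injective: equal children mean that a level 2 parent set contains both or neither, and all
  vertices of level 1 have the same parents.\<close>

lemma minimal_adjacent_1:
  assumes M: "minimal_prenet M" and xy: "x \<in> verts M 1" "y \<in> verts M 1" "x \<noteq> y"
    and adj: "\<And>z. z \<in> verts M 1 \<Longrightarrow> \<not> (x < z \<and> z < y) \<and> \<not> (y < z \<and> z < x)"
    and ch: "children M 2 x = children M 2 y"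
  shows False
proof -
  have M': "is_prenet M" using M by (simp add: minimal_prenet_def)
  have "retraction M (merge 1 x y)"
    using xy mono_on_merge[OF xy(2) adj, of 1 1] ch is_prenet_parents_1[OF M']
    by (auto simp: retraction_def merge_def mono_on_def inj_on_def children_def)
  from minimal_retraction_inj[OF M this, of 1] show False
    using xy by (auto simp: inj_on_def merge_def)
qed

text \<open>Again the merge of \<open>x\<close> into \<open>y\<close> would be a retraction. Since
  the vertex that moves is a tassel, the core stays fixed, whether or not \<open>y\<close> is
  core.\<close>

lemma minimal_adjacent_2:
  assumes M: "minimal_prenet M" and xy: "x \<in> verts M 2" "y \<in> verts M 2" "x \<noteq> y"
    and adj: "\<And>z. z \<in> verts M 2 \<Longrightarrow> \<not> (x < z \<and> z < y) \<and> \<not> (y < z \<and> z < x)"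
    and par: "parents M 2 x = parents M 2 y" and x: "x \<notin> core M"
  shows False
proof -
  have "retraction M (merge 2 x y)"
    using xy mono_on_merge[OF xy(2) adj, of 2 2] par x
    by (auto simp: retraction_def merge_def mono_on_def inj_on_def)
  from minimal_retraction_inj[OF M this, of 2] show False
    using xy by (auto simp: inj_on_def merge_def)
qed

section \<open>Comparing the fibres of two weak equivalences\<close>

lemma mono_on_adjacent_value:
  fixes f :: "'a::linorder \<Rightarrow> 'b::linorder"
  assumes A: "finite A" "mono_on A f" and uv: "u \<in> A" "v \<in> A" "f u \<noteq> f v"
  obtains w where "w \<in> A" "f w \<noteq> f u" "u \<le> w \<and> w \<le> v \<or> v \<le> w \<and> w \<le> u"
    "\<And>z. z \<in> f ` A \<Longrightarrow> \<not> (f u < z \<and> z < f w) \<and> \<not> (f w < z \<and> z < f u)"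
proof (cases "u < v")
  case True
  \<comment> \<open>Walking from \<open>u\<close> towards \<open>v\<close>, the witness is the first
    element with a new value. A value strictly in between would come from an element strictly in
    between, against this choice.\<close>
  define W where "W = {w \<in> A. u < w \<and> f w \<noteq> f u}"
  have W: "finite W" "v \<in> W" using A uv True by (auto simp: W_def)
  have w: "Min W \<in> W" using W by (metis Min_in empty_iff)
  then have le: "f u \<le> f (Min W)" using A(2) uv by (auto simp: W_def mono_on_def)
  show thesis
  proof (rule that)
    show "Min W \<in> A" "f (Min W) \<noteq> f u" using w by (auto simp: W_def)
    show "u \<le> Min W \<and> Min W \<le> v \<or> v \<le> Min W \<and> Min W \<le> u" using w W by (auto simp: W_def)
    show "\<not> (f u < z \<and> z < f (Min W)) \<and> \<not> (f (Min W) < z \<and> z < f u)" if z: "z \<in> f ` A" for z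
    proof -
      have False if "a \<in> A" "f u < f a" "f a < f (Min W)" for a
      proof -
        have "u < a" "a < Min W" using mono_onD'[OF A(2)] that uv w by (auto simp: W_def)
        then have "a \<in> W" using that by (auto simp: W_def)
        then show False using W \<open>a < Min W\<close> Min_le leD by blast
      qed
      then show ?thesis using z le by auto
    qed
  qed
next
  case False
  then have vu: "v < u" using uv by (metis not_less_iff_gr_or_eq)
  define W where "W = {w \<in> A. w < u \<and> f w \<noteq> f u}"
  have W: "finite W" "v \<in> W" using A uv vu by (auto simp: W_def)
  have w: "Max W \<in> W" using W by (metis Max_in empty_iff)
  then have le: "f (Max W) \<le> f u" using A(2) uv by (auto simp: W_def mono_on_def)
  show thesis
  proof (rule that)
    show "Max W \<in> A" "f (Max W) \<noteq> f u" using w by (auto simp: W_def)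
    show "u \<le> Max W \<and> Max W \<le> v \<or> v \<le> Max W \<and> Max W \<le> u" using w W by (auto simp: W_def)
    show "\<not> (f u < z \<and> z < f (Max W)) \<and> \<not> (f (Max W) < z \<and> z < f u)" if z: "z \<in> f ` A" for z
    proof -
      have False if "a \<in> A" "f a < f u" "f (Max W) < f a" for a
      proof -
        have "a < u" "Max W < a" using mono_onD'[OF A(2)] that uv w by (auto simp: W_def)
        then have "a \<in> W" using that by (auto simp: W_def)
        then show False using W \<open>Max W < a\<close> Max_ge leD by blast
      qed
      then show ?thesis using z le by auto
    qed
  qed
qed

text \<open>By saturation and surjectivity on level 1, the parent sets of a vertex and of its image
  are preimage and image of each other, so each determines the other.\<close>

lemma weak_equivalence_parents:
  assumes f: "weak_equivalence S T f" and xy: "x \<in> verts S 2" "y \<in> verts S 2"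
  shows "parents T 2 (f 2 x) = parents T 2 (f 2 y) \<longleftrightarrow> parents S 2 x = parents S 2 y"
proof -
  note F = weak_equivalenceD[OF f]
  have "parents S 2 z = {t \<in> verts S 1. f 1 t \<in> parents T 2 (f 2 z)} \<and>
    parents T 2 (f 2 z) = f 1 ` parents S 2 z" if z: "z \<in> verts S 2" for z
  proof -
    have "f 2 z \<in> verts T 2" using F(3)[of 2] z by auto
    then have "parents T 2 (f 2 z) \<subseteq> f 1 ` verts S 1"
      using is_prenetD(2)[OF F(2), of 2 "f 2 z"] F(3)[of 1] by simp
    moreover have "parents S 2 z \<subseteq> verts S 1" using is_prenetD(2)[OF F(1), of 2 z] z by simp
    ultimately show ?thesis using F(5)[of 2 z] z by auto
  qed
  then show ?thesis using xy by metis
qed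

text \<open>Surjectivity on level 2 allows children in \<open>T\<close> to be tested on the vertices
  of \<open>S\<close>, where saturation applies.\<close>

lemma weak_equivalence_children:
  assumes f: "weak_equivalence S T f" and st: "s \<in> verts S 1" "t \<in> verts S 1"
  shows "children T 2 (f 1 s) = children T 2 (f 1 t) \<longleftrightarrow> children S 2 s = children S 2 t"
proof -
  note F = weak_equivalenceD[OF f]
  have surj: "f 2 ` verts S 2 = verts T 2" using F(3) by simp
  have mem: "f 1 a \<in> parents T 2 (f 2 z) \<longleftrightarrow> a \<in> parents S 2 z"
    if "z \<in> verts S 2" "a \<in> verts S 1" for a z
    using F(5)[of 2 z a] that by simp
  have "children T 2 (f 1 s) = children T 2 (f 1 t) \<longleftrightarrow>
      (\<forall>y\<in>f 2 ` verts S 2. f 1 s \<in> parents T 2 y \<longleftrightarrow> f 1 t \<in> parents T 2 y)"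
    unfolding surj by (auto simp: children_def set_eq_iff)
  also have "\<dots> \<longleftrightarrow> (\<forall>z\<in>verts S 2. s \<in> parents S 2 z \<longleftrightarrow> t \<in> parents S 2 z)"
    unfolding ball_simps using mem st by (intro ball_cong) simp_all
  also have "\<dots> \<longleftrightarrow> children S 2 s = children S 2 t"
    by (auto simp: children_def set_eq_iff)
  finally show ?thesis .
qed

text \<open>Outside the core, a minimal target is at least as coarse as any other. If
  \<open>f\<close> separated \<open>u\<close> from \<open>v\<close>, it would separate
  \<open>u\<close> from some \<open>w\<close> between them with a neighbouring value in
  \<open>M\<close>. As \<open>g\<close> identifies \<open>u\<close> and \<open>w\<close>, they agree
  in children or parents in \<open>U\<close>, hence so do their images in \<open>M\<close>, which
  minimality forbids.\<close>

lemma minimal_fibres: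
  assumes f: "weak_equivalence U M f" and g: "weak_equivalence U N g" and M: "minimal_prenet M"
    and i: "i \<in> {0,1,2}" and uv: "u \<in> verts U i" "v \<in> verts U i" "g i u = g i v"
    and core: "i = 2 \<Longrightarrow> f i u \<notin> core M"
  shows "f i u = f i v"
proof (rule ccontr)
  note F = weak_equivalenceD[OF f] and G = weak_equivalenceD[OF g]
  assume ne: "f i u \<noteq> f i v"
  obtain w where w: "w \<in> verts U i" "f i w \<noteq> f i u" "u \<le> w \<and> w \<le> v \<or> v \<le> w \<and> w \<le> u"
    "\<And>z. z \<in> f i ` verts U i \<Longrightarrow> \<not> (f i u < z \<and> z < f i w) \<and> \<not> (f i w < z \<and> z < f i u)"
    using mono_on_adjacent_value[OF is_prenetD(1)[OF F(1) i] F(4)[OF i] uv(1,2) ne] by blast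
  \<comment> \<open>Monotonicity squeezes \<open>g i w\<close> between the equal values at
    \<open>u\<close> and \<open>v\<close>.\<close>
  have gw: "g i w = g i u"
    using w(1,3) uv mono_onD[OF G(4)[OF i]] by (metis order_antisym)
  have fv: "f i u \<in> verts M i" "f i w \<in> verts M i" using F(3)[OF i] uv(1) w(1) by auto
  have adj: "\<not> (f i u < z \<and> z < f i w) \<and> \<not> (f i w < z \<and> z < f i u)" if "z \<in> verts M i" for z
    using w(4) that F(3)[OF i] by blast
  consider "i = 0" | "i = 1" | "i = 2" using i by auto
  then show False
  proof cases
    case 1
    then show False using fv w(2) is_prenet_verts_0[OF F(2)] by auto
  next
    case 2
    have "children M 2 (f 1 u) = children M 2 (f 1 w)"
      using gw uv(1) w(1) 2 weak_equivalence_children[OF f] weak_equivalence_children[OF g] by metis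
    then show False using minimal_adjacent_1[OF M, of "f 1 u" "f 1 w"] fv w(2) adj 2 by metis
  next
    case 3
    have "parents M 2 (f 2 u) = parents M 2 (f 2 w)"
      using gw uv(1) w(1) 3 weak_equivalence_parents[OF f] weak_equivalence_parents[OF g] by metis
    then show False using minimal_adjacent_2[OF M, of "f 2 u" "f 2 w"] fv w(2) adj core 3 by metis
  qed
qed

section \<open>Sections and the comparison of minimal targets\<close>

definition core_section ::
  "'a prenet \<Rightarrow> 'b prenet \<Rightarrow> (nat \<Rightarrow> 'a \<Rightarrow> 'b) \<Rightarrow> (nat \<Rightarrow> 'b \<Rightarrow> 'a) \<Rightarrow> bool" where
  "core_section S T f s \<longleftrightarrow>
     (\<forall>i\<in>{0,1,2}. \<forall>x\<in>verts T i. s i x \<in> verts S i \<and> f i (s i x) = x) \<and> s 2 ` core T \<subseteq> core S"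

text \<open>A core vertex is lifted through the bijection of cores, any other vertex
  arbitrarily.\<close>

lemma core_section_exists:
  assumes "weak_equivalence S T f"
  obtains s where "core_section S T f s"
proof
  note F = weak_equivalenceD[OF assms]
  define s where "s = (\<lambda>i x. if i = 2 \<and> x \<in> core T then inv_into (core S) (f 2) x
                             else inv_into (verts S i) (f i) x)"
  have c: "s 2 x \<in> core S \<and> f 2 (s 2 x) = x" if "x \<in> core T" for x
    using F(6) that by (auto simp: s_def bij_betw_def f_inv_into_f inv_into_into)
  have "s i x \<in> verts S i \<and> f i (s i x) = x" if "i \<in> {0,1,2}" "x \<in> verts T i" for i x
  proof (cases "i = 2 \<and> x \<in> core T")
    case True
    then show ?thesis using c[of x] by (auto simp: core_def)
  next
    case False
    then have "s i x = inv_into (verts S i) (f i) x" by (auto simp: s_def)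
    then show ?thesis using F(3)[OF that(1)] that(2) by (auto simp: f_inv_into_f inv_into_into)
  qed
  then show "core_section S T f s" using c unfolding core_section_def by blast
qed

text \<open>The two lifts \<open>s i x\<close> and \<open>t i (g i (s i x))\<close> lie in one fibre
  of \<open>g\<close>. If \<open>x\<close> is core, both are core and hence equal; otherwise
  \<open>minimal_fibres\<close> shows that \<open>f\<close> identifies them.\<close>

lemma minimal_round_trip:
  assumes f: "weak_equivalence U M f" and g: "weak_equivalence U N g" and M: "minimal_prenet M"
    and s: "core_section U M f s" and t: "core_section U N g t"
    and i: "i \<in> {0,1,2}" and x: "x \<in> verts M i"
  shows "f i (t i (g i (s i x))) = x"
proof -
  note F = weak_equivalenceD[OF f] and G = weak_equivalenceD[OF g]
  let ?u = "s i x" and ?v = "t i (g i (s i x))"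
  have u: "?u \<in> verts U i" "f i ?u = x" using s i x unfolding core_section_def by blast+
  have "g i ?u \<in> verts N i" using G(3)[OF i] u(1) by blast
  then have v: "?v \<in> verts U i" "g i ?v = g i ?u" using t i unfolding core_section_def by blast+
  show ?thesis
  proof (cases "i = 2 \<and> x \<in> core M")
    case True
    then have "?u \<in> core U" using s unfolding core_section_def by blast
    moreover have "?v \<in> core U"
      using calculation G(6) t True unfolding core_section_def bij_betw_def by blast
    ultimately have "?v = ?u" using v(2) G(6) True by (auto simp: bij_betw_def inj_on_def)
    then show ?thesis using u by simp
  next
    case False
    then show ?thesis using minimal_fibres[OF f g M i u(1) v(1)] u v by metis
  qed
qed

text \<open>The composites \<open>h\<close> and \<open>k\<close> through \<open>U\<close> are
  mutually inverse, by the round trip applied in both directions.\<close>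

lemma minimal_targets_equivalent:
  assumes f: "weak_equivalence U M f" and g: "weak_equivalence U N g"
    and M: "minimal_prenet M" and N: "minimal_prenet N"
  shows "\<exists>h. weak_equivalence M N h"
proof -
  note F = weak_equivalenceD[OF f] and G = weak_equivalenceD[OF g]
  obtain s where s: "core_section U M f s" using core_section_exists[OF f] .
  obtain t where t: "core_section U N g t" using core_section_exists[OF g] .
  define h where "h = (\<lambda>i x. g i (s i x))"
  define k where "k = (\<lambda>i x. f i (t i x))"
  have kh: "k i (h i x) = x" if "i \<in> {0,1,2}" "x \<in> verts M i" for i x
    using minimal_round_trip[OF f g M s t that] by (simp add: h_def k_def)
  have hk: "h i (k i x) = x" if "i \<in> {0,1,2}" "x \<in> verts N i" for i x
    using minimal_round_trip[OF g f N t s that] by (simp add: h_def k_def)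
  have sv: "s i x \<in> verts U i" "f i (s i x) = x" if "i \<in> {0,1,2}" "x \<in> verts M i" for i x
    using s that unfolding core_section_def by blast+
  have tv: "t i x \<in> verts U i" if "i \<in> {0,1,2}" "x \<in> verts N i" for i x
    using t that unfolding core_section_def by blast
  have hN: "h i x \<in> verts N i" if "i \<in> {0,1,2}" "x \<in> verts M i" for i x
    using sv(1)[OF that] G(3)[OF that(1)] by (auto simp: h_def)
  have kM: "k i x \<in> verts M i" if "i \<in> {0,1,2}" "x \<in> verts N i" for i x
    using tv[OF that] F(3)[OF that(1)] by (auto simp: k_def)
  have hkc: "h 2 ` core M \<subseteq> core N" "k 2 ` core N \<subseteq> core M"
    using s t bij_betw_imp_surj_on[OF F(6)] bij_betw_imp_surj_on[OF G(6)]
    unfolding core_section_def h_def k_def by (auto simp: image_subset_iff)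
  have "weak_equivalence M N h"
  proof (rule weak_equivalenceI)
    show "is_prenet M" "is_prenet N" by (fact F G)+
    show "h i ` verts M i = verts N i" if "i \<in> {0,1,2}" for i
      using hN[OF that] kM[OF that] hk[OF that] by (auto intro!: image_eqI[of _ "h i" "k i _"])
    show "mono_on (verts M i) (h i)" if "i \<in> {0,1,2}" for i
    proof (rule mono_onI)
      fix x y assume xy: "x \<in> verts M i" "y \<in> verts M i" "x \<le> y"
      \<comment> \<open>The monotone map \<open>f i\<close> reflects strict inequalities, so every
        section of it is monotone.\<close>
      have "s i x \<le> s i y"
        using mono_onD'[OF F(4)[OF that] sv(1)[OF that xy(1)] sv(1)[OF that xy(2)]]
          sv(2)[OF that] xy by (cases "x = y") (simp_all add: order_le_less)
      then show "h i x \<le> h i y"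
        unfolding h_def using mono_onD[OF G(4)[OF that]] sv(1)[OF that] xy by blast
    qed
    show "h (i - 1) a \<in> parents N i (h i x) \<longleftrightarrow> a \<in> parents M i x"
      if i: "i \<in> {1,2}" and x: "x \<in> verts M i" and a: "a \<in> verts M (i - 1)" for i x a
    proof -
      have "i \<in> {0,1,2}" "i - 1 \<in> {0,1,2}" using i by auto
      note 1 = sv[OF this(1) x] and 2 = sv[OF this(2) a]
      \<comment> \<open>Both memberships are compared with the one between the lifts in
        \<open>U\<close>.\<close>
      show ?thesis unfolding h_def using G(5)[OF i 1(1) 2(1)] F(5)[OF i 1(1) 2(1)] 1 2 by simp
    qed
    have "\<forall>x\<in>core M. k 2 (h 2 x) = x" "\<forall>x\<in>core N. h 2 (k 2 x) = x"
      using kh[of 2] hk[of 2] by (auto simp: core_def)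
    then show "bij_betw (h 2) (core M) (core N)" using hkc by (rule bij_betw_byWitness)
  qed
  then show ?thesis by blast
qed

section \<open>Existence and uniqueness of the minimal prenet\<close>

lemma minimal_target_exists:
  fixes S :: "'a::linorder prenet"
  assumes "is_prenet S"
  shows "\<exists>(M :: 'a prenet) f. minimal_prenet M \<and> weak_equivalence S M f"
  using assms
\<comment> \<open>A weak equivalence that is not an isomorphism is surjective but not injective, so
  it lowers the number of vertices; level 0 always has exactly one.\<close>
proof (induction "card (verts S 1) + card (verts S 2)" arbitrary: S rule: less_induct)
  case less
  show ?case
  proof (cases "minimal_prenet S")
    case True
    then show ?thesis using weak_equivalence_id less.prems by blast
  next
    case False
    then obtain T :: "'a prenet" and f where f: "weak_equivalence S T f" "\<not> prenet_iso S T f"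
      using less.prems unfolding minimal_prenet_def by blast
    note F = weak_equivalenceD[OF f(1)]
    have le: "card (verts T i) \<le> card (verts S i)" if "i \<in> {0,1,2}" for i
      using F(3)[OF that] card_image_le[OF is_prenetD(1)[OF F(1) that]] by metis
    have inj: "inj_on (f i) (verts S i)" if "i \<in> {0,1,2}" "card (verts T i) = card (verts S i)" for i
      using F(3)[OF that(1)] eq_card_imp_inj_on[OF is_prenetD(1)[OF F(1) that(1)]] that(2) by metis
    have "inj_on (f 0) (verts S 0)" using is_prenet_verts_0[OF F(1)] by auto
    then have "\<not> (card (verts T 1) = card (verts S 1) \<and> card (verts T 2) = card (verts S 2))"
      using inj weak_equivalence_inj_imp_iso[OF f(1)] f(2) by blast
    then have "card (verts T 1) + card (verts T 2) < card (verts S 1) + card (verts S 2)"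
      using le[of 1] le[of 2] by auto
    then obtain M :: "'a prenet" and g where "minimal_prenet M" "weak_equivalence T M g" using less.hyps F(2) by blast
    then show ?thesis using weak_equivalence_comp[OF f(1)] by blast
  qed
qed

text \<open>Having a weak equivalence to \<open>M\<close> spreads along a zigzag. Against an arrow
  this is composition; along an arrow it uses the comparison of minimal targets.\<close>

lemma weq_component_minimal_target:
  fixes S T M :: "'a::linorder prenet"
  assumes "equivclp (\<lambda>U V. \<exists>f. weak_equivalence U V f) S T"
    and M: "minimal_prenet M" and "weak_equivalence S M f"
  shows "\<exists>g. weak_equivalence T M g"
  using assms(1)
proof (induction rule: equivclp_induct)
  case base
  show ?case using assms(3) by blast
next
  case (step U V)
  then obtain g where g: "weak_equivalence U M g" by blast
  from step(2) show ?case
  proof (elim disjE exE)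
    fix h assume h: "weak_equivalence U V h"
    \<comment> \<open>Through \<open>V\<close>, the prenet \<open>U\<close> also maps to the minimal
      \<open>N\<close>, so \<open>N\<close> maps to \<open>M\<close>.\<close>
    obtain N :: "'a prenet" and k where k: "minimal_prenet N" "weak_equivalence V N k"
      using minimal_target_exists weak_equivalenceD(2)[OF h] by blast
    then obtain l where "weak_equivalence N M l"
      using minimal_targets_equivalent[OF weak_equivalence_comp[OF h k(2)] g k(1) M] by blast
    then show ?thesis using weak_equivalence_comp[OF k(2)] by blast
  next
    fix h assume "weak_equivalence V U h"
    then show ?thesis using weak_equivalence_comp g by blast
  qed
qed

theorem proposition3p19:
  fixes S :: "'a::linorder prenet"
  assumes "is_prenet S"
  shows "\<exists>M. M \<in> weq_component S \<and> minimal_prenet M \<and>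
           (\<forall>M'. M' \<in> weq_component S \<and> minimal_prenet M' \<longrightarrow> isomorphic_prenets M' M) \<and>
           (\<exists>f. weak_equivalence S M f)"
proof -
  obtain M :: "'a prenet" and f where M: "minimal_prenet M" and f: "weak_equivalence S M f"
    using minimal_target_exists[OF assms] by blast
  have "M \<in> weq_component S"
    using f weak_equivalenceD(2)[OF f] unfolding weq_component_def by (blast intro: r_into_equivclp)
  moreover have "isomorphic_prenets M' M" if M': "M' \<in> weq_component S" "minimal_prenet M'"
    for M' :: "'a prenet"
  proof -
    \<comment> \<open>Minimality of \<open>M'\<close> turns this weak equivalence into an
      isomorphism.\<close>
    obtain g where "weak_equivalence M' M g"
      using weq_component_minimal_target[OF _ M f] M'(1) unfolding weq_component_def by blast
    then show ?thesis using M'(2) unfolding minimal_prenet_def isomorphic_prenets_def by blast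
  qed
  ultimately show ?thesis using M f by blast
qed

end
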